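(* Let $\mathbf S = (S, \vee)$ be a join semilattice. Then the lattice of compatible preorders on $\mathbf S$ is isomorphic, as a complete lattice, to the lattice of congruences on $\mathbf S$. An isomorphism is given by the function $\Psi_{\mathbf S}$ which assigns to a compatible preorder $\sqsubseteq$ the congruence $\Psi_{\mathbf S}(\sqsubseteq) = \Theta_{\sqsubseteq}$ defined by: $a \mathrel{\Theta_{\sqsubseteq}} b$ if both $a \sqsubseteq b$ and $b \sqsubseteq a$. The inverse of $\Psi_{\mathbf S}$ is the function $\Omega_{\mathbf S}$ which assigns to a congruence $\Theta$ the preorder $\sqsubseteq_{\Theta}$ defined by: $a \sqsubseteq_{\Theta} b$ if $a \vee b \mathrel{\Theta} b$.
   Context: For a join semilattice $\mathbf S=(S,\vee)$, let $\leq$ be the induced order ($a\leq b$ iff $a\vee b=b$). A preorder (reflexive and transitive relation) $\sqsubseteq$ on $S$ is called compatible if it is coarser than $\leq$ (that is, $a\leq b$ implies $a\sqsubseteq b$) and, for all $a,a_1,b\in S$, $a\sqsubseteq b$ and $a_1\sqsubseteq b$ imply $a\vee a_1\sqsubseteq b$. A congruence on $\mathbf S$ is an equivalence relation $\Theta$ on $S$ such that $a\mathrel{\Theta} b$ implies $a\vee c\mathrel{\Theta} b\vee c$ for all $a,b,c\in S$. Both the set of compatible preorders on $\mathbf S$ and the set of congruences on $\mathbf S$ are ordered by inclusion (as sets of pairs); each is a complete lattice in which meets are intersections. *)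

theory Defs
  imports "HOL-Algebra.Complete_Lattice"
begin

text \<open>
  A join semilattice is an \<^locale>\<open>upper_semilattice\<close>, with underlying set \<^term>\<open>carrier S\<close> and
  join \<open>x \<squnion>\<^bsub>S\<^esub> y\<close>. Its order is primitive in the library, and is the one induced by the join:
\<close>

lemma (in upper_semilattice) le_iff_join_eq:
  assumes x: "x \<in> carrier L" and y: "y \<in> carrier L"
  shows "x \<sqsubseteq> y \<longleftrightarrow> x \<squnion> y = y"
proof
  assume "x \<sqsubseteq> y"
  then have "x \<squnion> y \<sqsubseteq> y"
    using x y by (intro join_le) auto
  then show "x \<squnion> y = y"
    using x y by (intro le_antisym join_right) auto
next
  assume "x \<squnion> y = y"
  then show "x \<sqsubseteq> y"
    using join_left[OF x y] by simp
qed

definition compatible_preorder :: "('a, 'b) gorder_scheme \<Rightarrow> 'a rel \<Rightarrow> bool"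
  where "compatible_preorder S r \<longleftrightarrow>
    preorder_on (carrier S) r \<and>
    (\<forall>a\<in>carrier S. \<forall>b\<in>carrier S. a \<sqsubseteq>\<^bsub>S\<^esub> b \<longrightarrow> (a, b) \<in> r) \<and>
    (\<forall>a\<in>carrier S. \<forall>a1\<in>carrier S. \<forall>b\<in>carrier S.
      (a, b) \<in> r \<and> (a1, b) \<in> r \<longrightarrow> (a \<squnion>\<^bsub>S\<^esub> a1, b) \<in> r)"

definition join_congruence :: "('a, 'b) gorder_scheme \<Rightarrow> 'a rel \<Rightarrow> bool"
  where "join_congruence S \<Theta> \<longleftrightarrow>
    equiv (carrier S) \<Theta> \<and>
    (\<forall>a\<in>carrier S. \<forall>b\<in>carrier S. \<forall>c\<in>carrier S.
      (a, b) \<in> \<Theta> \<longrightarrow> (a \<squnion>\<^bsub>S\<^esub> c, b \<squnion>\<^bsub>S\<^esub> c) \<in> \<Theta>)"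

definition preorder_lattice :: "('a, 'b) gorder_scheme \<Rightarrow> 'a rel gorder"
  where "preorder_lattice S =
    \<lparr> carrier = {r. compatible_preorder S r}, eq = (=), le = (\<subseteq>) \<rparr>"

definition congruence_lattice :: "('a, 'b) gorder_scheme \<Rightarrow> 'a rel gorder"
  where "congruence_lattice S =
    \<lparr> carrier = {\<Theta>. join_congruence S \<Theta>}, eq = (=), le = (\<subseteq>) \<rparr>"

text \<open>
  \<^const>\<open>sup_pres\<close> and \<^const>\<open>inf_pres\<close> include that both structures are complete lattices, and
  range over all subsets of the carrier, the empty one included.
\<close>

definition complete_lattice_iso ::
    "('a, 'c) gorder_scheme \<Rightarrow> ('b, 'd) gorder_scheme \<Rightarrow> ('a \<Rightarrow> 'b) \<Rightarrow> bool"
  where "complete_lattice_iso X Y f \<longleftrightarrow>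
    bij_betw f (carrier X) (carrier Y) \<and> sup_pres X Y f \<and> inf_pres X Y f"

definition Psi :: "('a, 'b) gorder_scheme \<Rightarrow> 'a rel \<Rightarrow> 'a rel"
  where "Psi S r = {(a, b). a \<in> carrier S \<and> b \<in> carrier S \<and> (a, b) \<in> r \<and> (b, a) \<in> r}"

definition Omega :: "('a, 'b) gorder_scheme \<Rightarrow> 'a rel \<Rightarrow> 'a rel"
  where "Omega S \<Theta> = {(a, b). a \<in> carrier S \<and> b \<in> carrier S \<and> (a \<squnion>\<^bsub>S\<^esub> b, b) \<in> \<Theta>}"

end

theory Submission
  imports Defs
begin

text \<open>
  Within a join semilattice a compatible preorder \<open>r\<close> is determined by its symmetric part, because
  \<open>(a, b) \<in> r\<close> holds exactly when \<open>a \<squnion> b\<close> and \<open>b\<close> lie below each other in \<open>r\<close>: the pair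
  \<open>(b, a \<squnion> b)\<close> always belongs to \<open>r\<close>, and compatibility turns \<open>(a, b)\<close>, \<open>(b, b)\<close> into
  \<open>(a \<squnion> b, b)\<close>. This is \<open>Omega_Psi\<close>. Conversely a congruence \<open>\<Theta>\<close> relates \<open>a\<close> and \<open>b\<close> exactly
  when it relates both of them to \<open>a \<squnion> b\<close>, which is \<open>Psi_Omega\<close>. Hence \<^const>\<open>Psi\<close> and
  \<^const>\<open>Omega\<close> are mutually inverse bijections.

  Both maps visibly preserve inclusion, so they form an order isomorphism. An order isomorphism
  carries least upper bounds and greatest lower bounds to such bounds; as preorders and congruences
  are closed under intersection, both families are complete lattices, and the suprema and infima
  of all subsets are therefore preserved (\<open>complete_lattice_isoI\<close>).
\<close>

section \<open>Complete lattices ordered by inclusion and their isomorphisms\<close>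

lemma Inter_closed_complete_lattice:
  assumes top: "T \<in> C" "\<And>X. X \<in> C \<Longrightarrow> X \<subseteq> T"
    and Inter: "\<And>A. A \<subseteq> C \<Longrightarrow> A \<noteq> {} \<Longrightarrow> \<Inter>A \<in> C"
  shows "complete_lattice \<lparr>carrier = C, eq = (=), le = (\<subseteq>)\<rparr>" (is "complete_lattice ?L")
proof -
  interpret partial_order ?L
    by unfold_locales auto
  show ?thesis
  proof (rule complete_lattice_criterion1)
    show "\<exists>g. greatest ?L g (carrier ?L)"
      using top by (auto simp: greatest_def)
  next
    fix A assume "A \<subseteq> carrier ?L" "A \<noteq> {}"
    then have "greatest ?L (\<Inter>A) (Lower ?L A)"
      using Inter[of A] by (auto simp: greatest_def Lower_def)
    then show "\<exists>i. greatest ?L i (Lower ?L A)" ..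
  qed
qed

text \<open>
  Stated for \<open>least\<close> and \<open>Upper\<close> so that the version for infima is the same statement about the
  dual orders.
\<close>

lemma order_iso_least_Upper:
  assumes f: "f \<in> carrier X \<rightarrow> carrier Y" and g: "g \<in> carrier Y \<rightarrow> carrier X"
    and fg: "\<And>y. y \<in> carrier Y \<Longrightarrow> f (g y) = y"
    and emb: "\<And>x x'. x \<in> carrier X \<Longrightarrow> x' \<in> carrier X \<Longrightarrow> f x \<sqsubseteq>\<^bsub>Y\<^esub> f x' \<longleftrightarrow> x \<sqsubseteq>\<^bsub>X\<^esub> x'"
    and A: "A \<subseteq> carrier X" and s: "least X s (Upper X A)"
  shows "least Y (f s) (Upper Y (f ` A))"
  unfolding least_def
proof (intro conjI ballI)
  have sX: "s \<in> carrier X" and ub: "\<And>x. x \<in> A \<Longrightarrow> x \<sqsubseteq>\<^bsub>X\<^esub> s"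
    and min: "\<And>u. u \<in> Upper X A \<Longrightarrow> s \<sqsubseteq>\<^bsub>X\<^esub> u"
    using s A by (auto simp: least_def Upper_def)
  show "Upper Y (f ` A) \<subseteq> carrier Y"
    by (rule Upper_closed)
  show "f s \<in> Upper Y (f ` A)"
    using f sX ub A emb by (auto simp: Upper_def subset_iff)
  fix u assume u: "u \<in> Upper Y (f ` A)"
  then have uY: "u \<in> carrier Y" and guX: "g u \<in> carrier X"
    using g by (auto simp: Upper_def)
  have "g u \<in> Upper X A"
  proof -
    have "x \<sqsubseteq>\<^bsub>X\<^esub> g u" if "x \<in> A" for x
    proof -
      have "f x \<sqsubseteq>\<^bsub>Y\<^esub> f (g u)"
        using u uY fg f A that by (auto simp: Upper_def Pi_iff subset_iff)
      then show ?thesis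
        using emb guX A that by blast
    qed
    then show ?thesis
      using guX by (simp add: Upper_def)
  qed
  then have "f s \<sqsubseteq>\<^bsub>Y\<^esub> f (g u)"
    using min emb sX guX by blast
  then show "f s \<sqsubseteq>\<^bsub>Y\<^esub> u"
    using fg uY by simp
qed

lemma complete_lattice_isoI:
  assumes X: "complete_lattice X" and Y: "complete_lattice Y"
    and f: "f \<in> carrier X \<rightarrow> carrier Y" and g: "g \<in> carrier Y \<rightarrow> carrier X"
    and gf: "\<And>x. x \<in> carrier X \<Longrightarrow> g (f x) = x"
    and fg: "\<And>y. y \<in> carrier Y \<Longrightarrow> f (g y) = y"
    and f_mono: "\<And>x x'. x \<in> carrier X \<Longrightarrow> x' \<in> carrier X \<Longrightarrow> x \<sqsubseteq>\<^bsub>X\<^esub> x' \<Longrightarrow> f x \<sqsubseteq>\<^bsub>Y\<^esub> f x'"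
    and g_mono: "\<And>y y'. y \<in> carrier Y \<Longrightarrow> y' \<in> carrier Y \<Longrightarrow> y \<sqsubseteq>\<^bsub>Y\<^esub> y' \<Longrightarrow> g y \<sqsubseteq>\<^bsub>X\<^esub> g y'"
  shows "complete_lattice_iso X Y f"
proof -
  interpret X: complete_lattice X by (rule X)
  interpret Y: complete_lattice Y by (rule Y)
  have emb: "f x \<sqsubseteq>\<^bsub>Y\<^esub> f x' \<longleftrightarrow> x \<sqsubseteq>\<^bsub>X\<^esub> x'" if "x \<in> carrier X" "x' \<in> carrier X" for x x'
    using that f gf f_mono[of x x'] g_mono[of "f x" "f x'"] by (auto simp: Pi_iff)
  have bij: "bij_betw f (carrier X) (carrier Y)"
    using f g gf fg by (auto intro: bij_betw_byWitness[where f' = g])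
  have sup: "f (\<Squnion>\<^bsub>X\<^esub>A) = \<Squnion>\<^bsub>Y\<^esub>(f ` A)" if A: "A \<subseteq> carrier X" for A
  proof (rule Y.least_unique)
    show "least Y (f (\<Squnion>\<^bsub>X\<^esub>A)) (Upper Y (f ` A))"
      using order_iso_least_Upper[OF f g fg emb A] X.sup_lub[OF A] by blast
    show "least Y (\<Squnion>\<^bsub>Y\<^esub>(f ` A)) (Upper Y (f ` A))"
      using f A by (intro Y.sup_lub) auto
  qed
  have inf: "f (\<Sqinter>\<^bsub>X\<^esub>A) = \<Sqinter>\<^bsub>Y\<^esub>(f ` A)" if A: "A \<subseteq> carrier X" for A
  proof (rule Y.greatest_unique)
    show "greatest Y (f (\<Sqinter>\<^bsub>X\<^esub>A)) (Lower Y (f ` A))"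
      using order_iso_least_Upper[of f "inv_gorder X" "inv_gorder Y" g A "\<Sqinter>\<^bsub>X\<^esub>A"]
        f g fg emb A X.inf_glb[OF A]
      by simp
    show "greatest Y (\<Sqinter>\<^bsub>Y\<^esub>(f ` A)) (Lower Y (f ` A))"
      using f A by (intro Y.inf_glb) auto
  qed
  show ?thesis
    unfolding complete_lattice_iso_def sup_pres_def inf_pres_def
    using bij sup inf X Y by blast
qed

section \<open>Compatible preorders and congruences as complete lattices\<close>

lemma compatible_preorderD:
  assumes "compatible_preorder S r"
  shows compatible_preorder_subset: "r \<subseteq> carrier S \<times> carrier S"
    and compatible_preorder_refl: "a \<in> carrier S \<Longrightarrow> (a, a) \<in> r"
    and compatible_preorder_trans: "(a, b) \<in> r \<Longrightarrow> (b, c) \<in> r \<Longrightarrow> (a, c) \<in> r"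
    and compatible_preorder_le:
      "a \<in> carrier S \<Longrightarrow> b \<in> carrier S \<Longrightarrow> a \<sqsubseteq>\<^bsub>S\<^esub> b \<Longrightarrow> (a, b) \<in> r"
    and compatible_preorder_join: "(a, c) \<in> r \<Longrightarrow> (b, c) \<in> r \<Longrightarrow> (a \<squnion>\<^bsub>S\<^esub> b, c) \<in> r"
proof -
  have r: "r \<subseteq> carrier S \<times> carrier S" "refl_on (carrier S) r" "trans r"
    and le: "\<forall>a\<in>carrier S. \<forall>b\<in>carrier S. a \<sqsubseteq>\<^bsub>S\<^esub> b \<longrightarrow> (a, b) \<in> r"
    and join: "\<forall>a\<in>carrier S. \<forall>a1\<in>carrier S. \<forall>b\<in>carrier S.
      (a, b) \<in> r \<and> (a1, b) \<in> r \<longrightarrow> (a \<squnion>\<^bsub>S\<^esub> a1, b) \<in> r"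
    using assms unfolding compatible_preorder_def preorder_on_def by simp_all
  show "r \<subseteq> carrier S \<times> carrier S"
    by (rule r)
  show "(a, a) \<in> r" if "a \<in> carrier S"
    using r(2) that by (simp add: refl_on_def)
  show "(a, c) \<in> r" if "(a, b) \<in> r" "(b, c) \<in> r"
    using r(3) that by (rule transD)
  show "(a, b) \<in> r" if "a \<in> carrier S" "b \<in> carrier S" "a \<sqsubseteq>\<^bsub>S\<^esub> b"
    using le that by simp
  show "(a \<squnion>\<^bsub>S\<^esub> b, c) \<in> r" if "(a, c) \<in> r" "(b, c) \<in> r"
  proof -
    have "a \<in> carrier S" "b \<in> carrier S" "c \<in> carrier S"
      using r(1) that by auto
    then show ?thesis
      using join that by simp
  qed
qed

lemma join_congruenceD:
  assumes "join_congruence S \<Theta>"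
  shows join_congruence_subset: "\<Theta> \<subseteq> carrier S \<times> carrier S"
    and join_congruence_refl: "a \<in> carrier S \<Longrightarrow> (a, a) \<in> \<Theta>"
    and join_congruence_sym: "(a, b) \<in> \<Theta> \<Longrightarrow> (b, a) \<in> \<Theta>"
    and join_congruence_trans: "(a, b) \<in> \<Theta> \<Longrightarrow> (b, c) \<in> \<Theta> \<Longrightarrow> (a, c) \<in> \<Theta>"
    and join_congruence_join:
      "(a, b) \<in> \<Theta> \<Longrightarrow> c \<in> carrier S \<Longrightarrow> (a \<squnion>\<^bsub>S\<^esub> c, b \<squnion>\<^bsub>S\<^esub> c) \<in> \<Theta>"
proof -
  have eq: "\<Theta> \<subseteq> carrier S \<times> carrier S" "refl_on (carrier S) \<Theta>" "sym \<Theta>" "trans \<Theta>"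
    and join: "\<forall>a\<in>carrier S. \<forall>b\<in>carrier S. \<forall>c\<in>carrier S.
      (a, b) \<in> \<Theta> \<longrightarrow> (a \<squnion>\<^bsub>S\<^esub> c, b \<squnion>\<^bsub>S\<^esub> c) \<in> \<Theta>"
    using assms unfolding join_congruence_def equiv_def by simp_all
  show "\<Theta> \<subseteq> carrier S \<times> carrier S"
    by (rule eq)
  show "(a, a) \<in> \<Theta>" if "a \<in> carrier S"
    using eq(2) that by (simp add: refl_on_def)
  show "(b, a) \<in> \<Theta>" if "(a, b) \<in> \<Theta>"
    using eq(3) that by (rule symD)
  show "(a, c) \<in> \<Theta>" if "(a, b) \<in> \<Theta>" "(b, c) \<in> \<Theta>"
    using eq(4) that by (rule transD)
  show "(a \<squnion>\<^bsub>S\<^esub> c, b \<squnion>\<^bsub>S\<^esub> c) \<in> \<Theta>" if "(a, b) \<in> \<Theta>" "c \<in> carrier S"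
  proof -
    have "a \<in> carrier S" "b \<in> carrier S"
      using eq(1) that(1) by auto
    then show ?thesis
      using join that by simp
  qed
qed

context upper_semilattice
begin

lemma compatible_preorder_Times: "compatible_preorder L (carrier L \<times> carrier L)"
  by (auto simp: compatible_preorder_def preorder_on_def refl_on_def trans_def)

lemma compatible_preorder_Inter:
  assumes "\<And>r. r \<in> A \<Longrightarrow> compatible_preorder L r" "A \<noteq> {}"
  shows "compatible_preorder L (\<Inter>A)"
  unfolding compatible_preorder_def preorder_on_def
proof (intro conjI)
  show "\<Inter>A \<subseteq> carrier L \<times> carrier L"
    using assms(2) compatible_preorder_subset[OF assms(1)] by blast
  show "refl_on (carrier L) (\<Inter>A)"
    by (simp add: refl_on_def compatible_preorder_refl[OF assms(1)])
  show "trans (\<Inter>A)"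
    by (blast intro: transI compatible_preorder_trans[OF assms(1)])
qed (simp_all add: compatible_preorder_le[OF assms(1)] compatible_preorder_join[OF assms(1)])

lemma preorder_lattice_complete: "complete_lattice (preorder_lattice L)"
  unfolding preorder_lattice_def
proof (rule Inter_closed_complete_lattice)
  show "carrier L \<times> carrier L \<in> {r. compatible_preorder L r}"
    by (simp add: compatible_preorder_Times)
  show "X \<subseteq> carrier L \<times> carrier L" if "X \<in> {r. compatible_preorder L r}" for X
    using that by (simp add: compatible_preorder_subset)
  show "\<Inter>A \<in> {r. compatible_preorder L r}" if "A \<subseteq> {r. compatible_preorder L r}" "A \<noteq> {}" for A
    using that by (auto intro!: compatible_preorder_Inter)
qed

lemma join_congruence_Times: "join_congruence L (carrier L \<times> carrier L)"
  by (auto simp: join_congruence_def equiv_def refl_on_def sym_def trans_def)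

lemma join_congruence_Inter:
  assumes "\<And>\<Theta>. \<Theta> \<in> A \<Longrightarrow> join_congruence L \<Theta>" "A \<noteq> {}"
  shows "join_congruence L (\<Inter>A)"
  unfolding join_congruence_def equiv_def
proof (intro conjI)
  show "\<Inter>A \<subseteq> carrier L \<times> carrier L"
    using assms(2) join_congruence_subset[OF assms(1)] by blast
  show "refl_on (carrier L) (\<Inter>A)"
    by (simp add: refl_on_def join_congruence_refl[OF assms(1)])
  show "sym (\<Inter>A)"
    by (blast intro: symI join_congruence_sym[OF assms(1)])
  show "trans (\<Inter>A)"
    by (blast intro: transI join_congruence_trans[OF assms(1)])
qed (simp add: join_congruence_join[OF assms(1)])

lemma congruence_lattice_complete: "complete_lattice (congruence_lattice L)"
  unfolding congruence_lattice_def
proof (rule Inter_closed_complete_lattice)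
  show "carrier L \<times> carrier L \<in> {\<Theta>. join_congruence L \<Theta>}"
    by (simp add: join_congruence_Times)
  show "X \<subseteq> carrier L \<times> carrier L" if "X \<in> {\<Theta>. join_congruence L \<Theta>}" for X
    using that by (simp add: join_congruence_subset)
  show "\<Inter>A \<in> {\<Theta>. join_congruence L \<Theta>}" if "A \<subseteq> {\<Theta>. join_congruence L \<Theta>}" "A \<noteq> {}" for A
    using that by (auto intro!: join_congruence_Inter)
qed

section \<open>The correspondence\<close>

text \<open>
  A compatible preorder is monotone under joins: if \<open>a\<close> lies below \<open>b\<close>, then \<open>a\<close> and \<open>c\<close> both lie
  below \<open>b \<squnion> c\<close>, and so does their join. Applied in both directions this gives the congruence
  property of the symmetric part.
\<close>

lemma join_congruence_Psi:
  assumes r: "compatible_preorder L r"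
  shows "join_congruence L (Psi L r)"
proof -
  have mono: "(a \<squnion> c, b \<squnion> c) \<in> r" if "(a, b) \<in> r" "c \<in> carrier L" for a b c
  proof -
    have "b \<in> carrier L"
      using that compatible_preorder_subset[OF r] by blast
    then have "(b, b \<squnion> c) \<in> r" "(c, b \<squnion> c) \<in> r"
      using that by (auto intro!: compatible_preorder_le[OF r] join_left join_right)
    then show ?thesis
      using that by (blast intro: compatible_preorder_join[OF r] compatible_preorder_trans[OF r])
  qed
  have "equiv (carrier L) (Psi L r)"
    by (intro equivI symI transI)
      (auto simp: Psi_def refl_on_def intro: compatible_preorder_refl[OF r]
        compatible_preorder_trans[OF r])
  then show ?thesis
    unfolding join_congruence_def by (auto simp: Psi_def intro: mono)
qed

lemma compatible_preorder_Omega: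
  assumes \<Theta>: "join_congruence L \<Theta>"
  shows "compatible_preorder L (Omega L \<Theta>)"
proof -
  note [trans] = join_congruence_trans[OF \<Theta>]
  have cong: "(a \<squnion> b, a \<squnion> c) \<in> \<Theta>" if "(b, c) \<in> \<Theta>" "a \<in> carrier L" for a b c
    using join_congruence_join[OF \<Theta> that] by (simp add: join_comm)
  have le: "(a, b) \<in> Omega L \<Theta>" if "a \<in> carrier L" "b \<in> carrier L" "a \<sqsubseteq> b" for a b
    using that le_iff_join_eq[of a b] join_congruence_refl[OF \<Theta>, of b] by (simp add: Omega_def)
  have trans: "(a, c) \<in> Omega L \<Theta>"
    if ab: "(a, b) \<in> Omega L \<Theta>" and bc: "(b, c) \<in> Omega L \<Theta>" for a b c
  proof -
    have mem: "a \<in> carrier L" "b \<in> carrier L" "c \<in> carrier L"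
      and ab': "(a \<squnion> b, b) \<in> \<Theta>" and bc': "(b \<squnion> c, c) \<in> \<Theta>"
      using ab bc by (auto simp: Omega_def)
    have "(a \<squnion> c, a \<squnion> (b \<squnion> c)) \<in> \<Theta>"
      using cong join_congruence_sym[OF \<Theta> bc'] mem by blast
    also have "a \<squnion> (b \<squnion> c) = a \<squnion> b \<squnion> c"
      using mem by (simp add: join_assoc)
    also have "(a \<squnion> b \<squnion> c, b \<squnion> c) \<in> \<Theta>"
      using join_congruence_join[OF \<Theta> ab'] mem by blast
    also note bc'
    finally show ?thesis
      using mem by (simp add: Omega_def)
  qed
  have join: "(a \<squnion> b, c) \<in> Omega L \<Theta>"
    if ac: "(a, c) \<in> Omega L \<Theta>" and bc: "(b, c) \<in> Omega L \<Theta>" for a b c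
  proof -
    have mem: "a \<in> carrier L" "b \<in> carrier L" "c \<in> carrier L"
      and ac': "(a \<squnion> c, c) \<in> \<Theta>" and bc': "(b \<squnion> c, c) \<in> \<Theta>"
      using ac bc by (auto simp: Omega_def)
    have "a \<squnion> b \<squnion> c = a \<squnion> (b \<squnion> c)"
      using mem by (simp add: join_assoc)
    also have "(a \<squnion> (b \<squnion> c), a \<squnion> c) \<in> \<Theta>"
      using cong bc' mem by blast
    also note ac'
    finally show ?thesis
      using mem by (simp add: Omega_def)
  qed
  show ?thesis
    unfolding compatible_preorder_def preorder_on_def
  proof (intro conjI)
    show "Omega L \<Theta> \<subseteq> carrier L \<times> carrier L"
      by (auto simp: Omega_def)
    show "refl_on (carrier L) (Omega L \<Theta>)"
      by (auto simp: refl_on_def intro: le)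
    show "trans (Omega L \<Theta>)"
      by (blast intro: transI trans)
  qed (use le join in blast)+
qed

text \<open>
  The pair \<open>(b, a \<squnion> b)\<close> lies in every compatible preorder, so the congruence condition on
  \<open>a \<squnion> b\<close> and \<open>b\<close> reduces to \<open>(a \<squnion> b, b) \<in> r\<close>, which is equivalent to \<open>(a, b) \<in> r\<close>.
\<close>

lemma Omega_Psi:
  assumes r: "compatible_preorder L r"
  shows "Omega L (Psi L r) = r"
proof -
  have "(a, b) \<in> Omega L (Psi L r) \<longleftrightarrow> (a, b) \<in> r"
    if mem: "a \<in> carrier L" "b \<in> carrier L" for a b
  proof -
    have le: "(a, a \<squnion> b) \<in> r" "(b, a \<squnion> b) \<in> r"
      using mem by (auto intro!: compatible_preorder_le[OF r] join_left join_right)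
    have "(a, b) \<in> Omega L (Psi L r) \<longleftrightarrow> (a \<squnion> b, b) \<in> r"
      using mem le by (simp add: Omega_def Psi_def)
    also have "\<dots> \<longleftrightarrow> (a, b) \<in> r"
      using le mem by (blast intro: compatible_preorder_trans[OF r]
          compatible_preorder_join[OF r] compatible_preorder_refl[OF r])
    finally show ?thesis .
  qed
  moreover have "Omega L (Psi L r) \<subseteq> carrier L \<times> carrier L"
    by (auto simp: Omega_def)
  ultimately show ?thesis
    using compatible_preorder_subset[OF r] by auto
qed

text \<open>
  If \<open>\<Theta>\<close> relates \<open>a\<close> and \<open>b\<close>, then joining both with \<open>b\<close> relates \<open>a \<squnion> b\<close> to \<open>b\<close> by
  idempotence, and hence also to \<open>a\<close>; the converse is transitivity through \<open>a \<squnion> b\<close>.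
\<close>

lemma Psi_Omega:
  assumes \<Theta>: "join_congruence L \<Theta>"
  shows "Psi L (Omega L \<Theta>) = \<Theta>"
proof -
  have "(a, b) \<in> Psi L (Omega L \<Theta>) \<longleftrightarrow> (a, b) \<in> \<Theta>"
    if mem: "a \<in> carrier L" "b \<in> carrier L" for a b
  proof -
    have idem: "x \<squnion> x = x" if "x \<in> carrier L" for x
      using le_iff_join_eq[of x x] that by simp
    have "(a, b) \<in> Psi L (Omega L \<Theta>) \<longleftrightarrow> (a \<squnion> b, b) \<in> \<Theta> \<and> (a \<squnion> b, a) \<in> \<Theta>"
      using mem by (auto simp: Psi_def Omega_def join_comm[of L b a])
    also have "\<dots> \<longleftrightarrow> (a, b) \<in> \<Theta>"
    proof
      assume "(a \<squnion> b, b) \<in> \<Theta> \<and> (a \<squnion> b, a) \<in> \<Theta>"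
      then show "(a, b) \<in> \<Theta>"
        by (blast intro: join_congruence_trans[OF \<Theta>] join_congruence_sym[OF \<Theta>])
    next
      assume ab: "(a, b) \<in> \<Theta>"
      have "(a \<squnion> b, b) \<in> \<Theta>"
        using join_congruence_join[OF \<Theta> ab mem(2)] idem mem by simp
      moreover have "(a \<squnion> b, a) \<in> \<Theta>"
        using calculation ab
        by (blast intro: join_congruence_trans[OF \<Theta>] join_congruence_sym[OF \<Theta>])
      ultimately show "(a \<squnion> b, b) \<in> \<Theta> \<and> (a \<squnion> b, a) \<in> \<Theta>" ..
    qed
    finally show ?thesis .
  qed
  moreover have "Psi L (Omega L \<Theta>) \<subseteq> carrier L \<times> carrier L"
    by (auto simp: Psi_def)
  ultimately show ?thesis
    using join_congruence_subset[OF \<Theta>] by auto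
qed

end

theorem theorem2p1:
  fixes S :: "('a, 'b) gorder_scheme"
  assumes "upper_semilattice S"
  shows "complete_lattice_iso (preorder_lattice S) (congruence_lattice S) (Psi S) \<and>
    Omega S \<in> carrier (congruence_lattice S) \<rightarrow> carrier (preorder_lattice S) \<and>
    (\<forall>r \<in> carrier (preorder_lattice S). Omega S (Psi S r) = r) \<and>
    (\<forall>\<Theta> \<in> carrier (congruence_lattice S). Psi S (Omega S \<Theta>) = \<Theta>)"
proof -
  interpret upper_semilattice S by (rule assms)
  have Psi: "Psi S \<in> carrier (preorder_lattice S) \<rightarrow> carrier (congruence_lattice S)"
    by (simp add: preorder_lattice_def congruence_lattice_def join_congruence_Psi)
  have Omega: "Omega S \<in> carrier (congruence_lattice S) \<rightarrow> carrier (preorder_lattice S)"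
    by (simp add: preorder_lattice_def congruence_lattice_def compatible_preorder_Omega)
  have OP: "Omega S (Psi S r) = r" if "r \<in> carrier (preorder_lattice S)" for r
    using that by (simp add: preorder_lattice_def Omega_Psi)
  have PO: "Psi S (Omega S \<Theta>) = \<Theta>" if "\<Theta> \<in> carrier (congruence_lattice S)" for \<Theta>
    using that by (simp add: congruence_lattice_def Psi_Omega)
  have "complete_lattice_iso (preorder_lattice S) (congruence_lattice S) (Psi S)"
  proof (rule complete_lattice_isoI[OF preorder_lattice_complete congruence_lattice_complete
        Psi Omega OP PO])
    show "Psi S r \<sqsubseteq>\<^bsub>congruence_lattice S\<^esub> Psi S r'" if "r \<sqsubseteq>\<^bsub>preorder_lattice S\<^esub> r'" for r r'
      using that by (auto simp: preorder_lattice_def congruence_lattice_def Psi_def)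
    show "Omega S \<Theta> \<sqsubseteq>\<^bsub>preorder_lattice S\<^esub> Omega S \<Theta>'" if "\<Theta> \<sqsubseteq>\<^bsub>congruence_lattice S\<^esub> \<Theta>'" for \<Theta> \<Theta>'
      using that by (auto simp: preorder_lattice_def congruence_lattice_def Omega_def)
  qed
  then show ?thesis
    using Omega OP PO by blast
qed

end
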